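(* Let $m,n\in\{0,1,2,\dots\}$, and let $Q$ and $R$ be non-degenerate symmetric bilinear forms on $V_m$ and $V_n$ respectively, with respect to which $V_m$ and $V_n$ are $*$-representations of $\mathfrak{sl}_2(\mathbb{R})$. Then the forms $\omega_k$, $0\le k\le\min\{m,n\}$, are positive/negative definite, alternating with $k$; that is, there is a sign $\varepsilon\in\{1,-1\}$ such that for every integer $k$ with $0\le k\le\min\{m,n\}$ the form $\varepsilon(-1)^k\omega_k$ on $P_{-m-n+2k}$ is positive definite.
   Context: Let $X,Y,H$ be the standard basis of the Lie algebra $\mathfrak{g}=\mathfrak{sl}_2(\mathbb{R})$, with $[X,Y]=H$, $[H,X]=2X$, $[H,Y]=-2Y$. Let $*$ be the ($\mathbb{R}$-linear) anti-involution on $\mathfrak{g}$ given by $X^*=X$, $Y^*=Y$, $H^*=-H$. Given a finite-dimensional real vector space $V$ with a non-degenerate symmetric bilinear form $Q$, a representation of $\mathfrak{g}$ on $V$ is a $*$-representation with respect to $Q$ if $Q(xu,v)=Q(u,x^*v)$ for all $x\in\mathfrak{g}$, $u,v\in V$. For $m\in\{0,1,2,\dots\}$, $V_m$ denotes the $(m+1)$-dimensional irreducible real representation of $\mathfrak{g}$ with basis $\{e_{-m+2i}\mid 0\le i\le m\}$ and action (with the convention $e_{-m-2}=e_{m+2}=0$), for $0\le i\le m$: $He_{m-2i}=(m-2i)e_{m-2i}$, $Ye_{m-2i}=e_{m-2(i+1)}$, $Xe_{m-2i}=i(m-i+1)e_{m-2(i-1)}$. The tensor product $V_m\otimes V_n$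 carries the usual action $x(u\otimes v)=xu\otimes v+u\otimes xv$ for $x\in\mathfrak{g}$, and the induced bilinear form $Q\otimes R$ determined by $(Q\otimes R)(u\otimes v,u'\otimes v')=Q(u,u')R(v,v')$. For $0\le k\le\min\{m,n\}$, $P_{-m-n+2k}$ denotes the kernel of $Y$ acting on the weight subspace of $V_m\otimes V_n$ of weight $-m-n+2k$, that is, $P_{-m-n+2k}=\{v\in V_m\otimes V_n\mid Hv=(-m-n+2k)v,\ Yv=0\}$. The symmetric bilinear form $\omega_k:P_{-m-n+2k}\times P_{-m-n+2k}\to\mathbb{R}$ is defined by $\omega_k(v,w)=(Q\otimes R)(v,X^{m+n-2k}w)$. *)

theory Defs
  imports "HOL-Analysis.Analysis" "HOL-Analysis.Finite_Function_Topology"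
begin

subsection \<open>The Lie algebra and its anti-involution\<close>

definition sl2 :: "(real^2^2) set" where
  "sl2 = {A. trace A = 0}"

definition bracket :: "real^2^2 \<Rightarrow> real^2^2 \<Rightarrow> real^2^2" where
  "bracket A B = A ** B - B ** A"

definition sl2_X :: "real^2^2" where
  "sl2_X = vector [vector [0, 1], vector [0, 0]]"

definition sl2_Y :: "real^2^2" where
  "sl2_Y = vector [vector [0, 0], vector [1, 0]]"

definition sl2_H :: "real^2^2" where
  "sl2_H = vector [vector [1, 0], vector [0, -1]]"

text \<open>An element \<open>A\<close> of \<open>sl2\<close> has the coordinates \<open>A$1$2\<close>, \<open>A$2$1\<close>, \<open>A$1$1\<close> with respect to
  the basis \<open>X\<close>, \<open>Y\<close>, \<open>H\<close> (lemma \<open>sl2_expand\<close>).\<close>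

definition sl2_star :: "real^2^2 \<Rightarrow> real^2^2" where
  "sl2_star A = A$1$2 *\<^sub>R sl2_X + A$2$1 *\<^sub>R sl2_Y - A$1$1 *\<^sub>R sl2_H"

lemmas sl2_defs = sl2_def bracket_def sl2_X_def sl2_Y_def sl2_H_def sl2_star_def

lemma sl2_basis_mem: "sl2_X \<in> sl2" "sl2_Y \<in> sl2" "sl2_H \<in> sl2"
  by (simp_all add: sl2_defs trace_def sum_2)

lemma sl2_expand: "A \<in> sl2 \<Longrightarrow> A = A$1$2 *\<^sub>R sl2_X + A$2$1 *\<^sub>R sl2_Y + A$1$1 *\<^sub>R sl2_H"
  by (simp add: sl2_defs trace_def sum_2 vec_eq_iff forall_2)

lemma sl2_brackets:
  "bracket sl2_X sl2_Y = sl2_H"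
  "bracket sl2_H sl2_X = 2 *\<^sub>R sl2_X"
  "bracket sl2_H sl2_Y = (-2) *\<^sub>R sl2_Y"
  by (simp_all add: sl2_defs matrix_matrix_mult_def vec_eq_iff forall_2 sum_2)

lemma sl2_star_basis:
  "sl2_star sl2_X = sl2_X" "sl2_star sl2_Y = sl2_Y" "sl2_star sl2_H = - sl2_H"
  by (simp_all add: sl2_defs vec_eq_iff forall_2)

lemma sl2_bracket_closed: "A \<in> sl2 \<Longrightarrow> B \<in> sl2 \<Longrightarrow> bracket A B \<in> sl2"
  by (simp add: sl2_defs trace_def sum_2 matrix_matrix_mult_def)

lemma sl2_star_closed: "A \<in> sl2 \<Longrightarrow> sl2_star A \<in> sl2"
  by (simp add: sl2_defs trace_def sum_2)

lemma linear_sl2_star: "linear sl2_star"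
  by (rule linearI) (simp_all add: sl2_defs vec_eq_iff forall_2)

lemma sl2_star_star: "A \<in> sl2 \<Longrightarrow> sl2_star (sl2_star A) = A"
  by (simp add: sl2_defs trace_def sum_2 vec_eq_iff forall_2)

lemma sl2_star_bracket:
  assumes "A \<in> sl2" "B \<in> sl2"
  shows "sl2_star (bracket A B) = bracket (sl2_star B) (sl2_star A)"
proof -
  have "A$2$2 = - A$1$1" "B$2$2 = - B$1$1"
    using assms by (auto simp: sl2_def trace_def sum_2)
  then show ?thesis
    by (simp add: sl2_defs matrix_matrix_mult_def vec_eq_iff forall_2 sum_2 algebra_simps)
qed


subsection \<open>Representations and bilinear forms on a subspace\<close>

definition linear_on :: "'v::real_vector set \<Rightarrow> ('v \<Rightarrow> 'w::real_vector) \<Rightarrow> bool" where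
  "linear_on V f \<longleftrightarrow>
     (\<forall>u\<in>V. \<forall>v\<in>V. f (u + v) = f u + f v) \<and> (\<forall>c. \<forall>u\<in>V. f (c *\<^sub>R u) = c *\<^sub>R f u)"

definition sl2_rep :: "'v::real_vector set \<Rightarrow> (real^2^2 \<Rightarrow> 'v \<Rightarrow> 'v) \<Rightarrow> bool" where
  "sl2_rep V \<rho> \<longleftrightarrow>
     subspace V \<and>
     (\<forall>A\<in>sl2. linear_on V (\<rho> A) \<and> \<rho> A ` V \<subseteq> V) \<and>
     (\<forall>v\<in>V. linear_on sl2 (\<lambda>A. \<rho> A v)) \<and>
     (\<forall>A\<in>sl2. \<forall>B\<in>sl2. \<forall>v\<in>V. \<rho> (bracket A B) v = \<rho> A (\<rho> B v) - \<rho> B (\<rho> A v))"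

definition bilinear_on :: "'v::real_vector set \<Rightarrow> ('v \<Rightarrow> 'v \<Rightarrow> real) \<Rightarrow> bool" where
  "bilinear_on V Q \<longleftrightarrow> (\<forall>u\<in>V. linear_on V (Q u)) \<and> (\<forall>v\<in>V. linear_on V (\<lambda>u. Q u v))"

definition symmetric_on :: "'v set \<Rightarrow> ('v \<Rightarrow> 'v \<Rightarrow> real) \<Rightarrow> bool" where
  "symmetric_on V Q \<longleftrightarrow> (\<forall>u\<in>V. \<forall>v\<in>V. Q u v = Q v u)"

definition nondegenerate_on :: "'v::real_vector set \<Rightarrow> ('v \<Rightarrow> 'v \<Rightarrow> real) \<Rightarrow> bool" where
  "nondegenerate_on V Q \<longleftrightarrow> (\<forall>u\<in>V. (\<forall>v\<in>V. Q u v = 0) \<longrightarrow> u = 0)"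

definition pos_definite_on :: "'v::real_vector set \<Rightarrow> ('v \<Rightarrow> 'v \<Rightarrow> real) \<Rightarrow> bool" where
  "pos_definite_on V Q \<longleftrightarrow> (\<forall>v\<in>V. v \<noteq> 0 \<longrightarrow> 0 < Q v v)"

definition star_rep ::
    "'v::real_vector set \<Rightarrow> (real^2^2 \<Rightarrow> 'v \<Rightarrow> 'v) \<Rightarrow> ('v \<Rightarrow> 'v \<Rightarrow> real) \<Rightarrow> bool" where
  "star_rep V \<rho> Q \<longleftrightarrow>
     sl2_rep V \<rho> \<and> (\<forall>A\<in>sl2. \<forall>u\<in>V. \<forall>v\<in>V. Q (\<rho> A u) v = Q u (\<rho> (sl2_star A) v))"


subsection \<open>The irreducible representations\<close>

text \<open>Vectors are finitely supported functions on the integers; the basis vector \<open>e\<^sub>w\<close> is the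
  indicator of the weight \<open>w\<close>, and is \<open>0\<close> if \<open>w\<close> is not a weight of the representation.\<close>

definition weights :: "nat \<Rightarrow> int set" where
  "weights m = (\<lambda>i. - int m + 2 * int i) ` {..m}"

definition e_vec :: "nat \<Rightarrow> int \<Rightarrow> (int \<Rightarrow>\<^sub>0 real)" where
  "e_vec m w = (if w \<in> weights m then Poly_Mapping.single w 1 else 0)"

definition irrep_space :: "nat \<Rightarrow> (int \<Rightarrow>\<^sub>0 real) set" where
  "irrep_space m = span (e_vec m ` weights m)"

text \<open>The summation index \<open>i\<close> below stands for the basis vector of weight \<open>m - 2 * i\<close>.\<close>

definition irrep_H :: "nat \<Rightarrow> (int \<Rightarrow>\<^sub>0 real) \<Rightarrow> (int \<Rightarrow>\<^sub>0 real)" where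
  "irrep_H m v = (\<Sum>i\<le>m. Poly_Mapping.lookup v (int m - 2 * int i) *\<^sub>R
     ((real m - 2 * real i) *\<^sub>R e_vec m (int m - 2 * int i)))"

definition irrep_Y :: "nat \<Rightarrow> (int \<Rightarrow>\<^sub>0 real) \<Rightarrow> (int \<Rightarrow>\<^sub>0 real)" where
  "irrep_Y m v = (\<Sum>i\<le>m. Poly_Mapping.lookup v (int m - 2 * int i) *\<^sub>R
     e_vec m (int m - 2 * (int i + 1)))"

definition irrep_X :: "nat \<Rightarrow> (int \<Rightarrow>\<^sub>0 real) \<Rightarrow> (int \<Rightarrow>\<^sub>0 real)" where
  "irrep_X m v = (\<Sum>i\<le>m. Poly_Mapping.lookup v (int m - 2 * int i) *\<^sub>R
     ((real i * (real m - real i + 1)) *\<^sub>R e_vec m (int m - 2 * (int i - 1))))"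

definition irrep :: "nat \<Rightarrow> real^2^2 \<Rightarrow> (int \<Rightarrow>\<^sub>0 real) \<Rightarrow> (int \<Rightarrow>\<^sub>0 real)" where
  "irrep m A v = A$1$2 *\<^sub>R irrep_X m v + A$2$1 *\<^sub>R irrep_Y m v + A$1$1 *\<^sub>R irrep_H m v"


subsection \<open>Tensor products\<close>

text \<open>The tensor product of spaces with bases indexed by \<open>'a\<close> and \<open>'b\<close> is realised on the
  product basis, indexed by \<open>'a \<times> 'b\<close>. Action and form on it are the (bi)linear extensions from
  the product basis; lemmas \<open>tensor_rep_tensor\<close> and \<open>tensor_form_tensor\<close> give their values on
  arbitrary pure tensors.\<close>

definition tensor :: "('a \<Rightarrow>\<^sub>0 real) \<Rightarrow> ('b \<Rightarrow>\<^sub>0 real) \<Rightarrow> ('a \<times> 'b \<Rightarrow>\<^sub>0 real)" where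
  "tensor u v = (\<Sum>p\<in>Poly_Mapping.keys u. \<Sum>q\<in>Poly_Mapping.keys v.
     Poly_Mapping.single (p, q) (Poly_Mapping.lookup u p * Poly_Mapping.lookup v q))"

definition tensor_space ::
    "('a \<Rightarrow>\<^sub>0 real) set \<Rightarrow> ('b \<Rightarrow>\<^sub>0 real) set \<Rightarrow> ('a \<times> 'b \<Rightarrow>\<^sub>0 real) set" where
  "tensor_space V W = span {tensor u v | u v. u \<in> V \<and> v \<in> W}"

definition tensor_rep ::
    "(real^2^2 \<Rightarrow> ('a \<Rightarrow>\<^sub>0 real) \<Rightarrow> ('a \<Rightarrow>\<^sub>0 real)) \<Rightarrow>
     (real^2^2 \<Rightarrow> ('b \<Rightarrow>\<^sub>0 real) \<Rightarrow> ('b \<Rightarrow>\<^sub>0 real)) \<Rightarrow>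
     real^2^2 \<Rightarrow> ('a \<times> 'b \<Rightarrow>\<^sub>0 real) \<Rightarrow> ('a \<times> 'b \<Rightarrow>\<^sub>0 real)" where
  "tensor_rep \<rho> \<sigma> A t = (\<Sum>(p, q)\<in>Poly_Mapping.keys t. Poly_Mapping.lookup t (p, q) *\<^sub>R
     (tensor (\<rho> A (Poly_Mapping.single p 1)) (Poly_Mapping.single q 1) +
      tensor (Poly_Mapping.single p 1) (\<sigma> A (Poly_Mapping.single q 1))))"

definition tensor_form ::
    "(('a \<Rightarrow>\<^sub>0 real) \<Rightarrow> ('a \<Rightarrow>\<^sub>0 real) \<Rightarrow> real) \<Rightarrow> (('b \<Rightarrow>\<^sub>0 real) \<Rightarrow> ('b \<Rightarrow>\<^sub>0 real) \<Rightarrow> real) \<Rightarrow>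
     ('a \<times> 'b \<Rightarrow>\<^sub>0 real) \<Rightarrow> ('a \<times> 'b \<Rightarrow>\<^sub>0 real) \<Rightarrow> real" where
  "tensor_form Q R s t =
     (\<Sum>(p, q)\<in>Poly_Mapping.keys s. \<Sum>(p', q')\<in>Poly_Mapping.keys t.
        Poly_Mapping.lookup s (p, q) * Poly_Mapping.lookup t (p', q') *
        (Q (Poly_Mapping.single p 1) (Poly_Mapping.single p' 1) *
         R (Poly_Mapping.single q 1) (Poly_Mapping.single q' 1)))"


subsection \<open>The spaces \<open>P\<close> and the forms \<open>\<omega>\<close>\<close>

text \<open>\<open>P_space m n k\<close> is the space $P_{-m-n+2k}$.\<close>

definition P_space :: "nat \<Rightarrow> nat \<Rightarrow> nat \<Rightarrow> (int \<times> int \<Rightarrow>\<^sub>0 real) set" where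
  "P_space m n k = {v \<in> tensor_space (irrep_space m) (irrep_space n).
     tensor_rep (irrep m) (irrep n) sl2_H v = (- real m - real n + 2 * real k) *\<^sub>R v \<and>
     tensor_rep (irrep m) (irrep n) sl2_Y v = 0}"

text \<open>The natural number subtraction in the exponent is exact for \<open>k \<le> min m n\<close>, which is the
  range in which the form is considered.\<close>

definition omega ::
    "((int \<Rightarrow>\<^sub>0 real) \<Rightarrow> (int \<Rightarrow>\<^sub>0 real) \<Rightarrow> real) \<Rightarrow> ((int \<Rightarrow>\<^sub>0 real) \<Rightarrow> (int \<Rightarrow>\<^sub>0 real) \<Rightarrow> real) \<Rightarrow>
     nat \<Rightarrow> nat \<Rightarrow> nat \<Rightarrow> (int \<times> int \<Rightarrow>\<^sub>0 real) \<Rightarrow> (int \<times> int \<Rightarrow>\<^sub>0 real) \<Rightarrow> real" where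
  "omega Q R m n k v w =
     tensor_form Q R v ((tensor_rep (irrep m) (irrep n) sl2_X ^^ (m + n - 2 * k)) w)"

subsection \<open>Consistency of the definitions\<close>

lemma lookup_scaleR: "Poly_Mapping.lookup (c *\<^sub>R v) i = c *\<^sub>R Poly_Mapping.lookup v i"
proof -
  have "finite {i. c *\<^sub>R Poly_Mapping.lookup v i \<noteq> 0}"
    by (rule finite_subset[OF _ finite_lookup[of v]]) auto
  then show ?thesis
    by (simp add: scaleR_poly_mapping_def)
qed

lemma weights_iff: "int m - 2 * i \<in> weights m \<longleftrightarrow> 0 \<le> i \<and> i \<le> int m"
proof
  assume "int m - 2 * i \<in> weights m"
  then obtain j where "j \<le> m" "int m - 2 * i = - int m + 2 * int j"
    by (auto simp: weights_def)
  then show "0 \<le> i \<and> i \<le> int m" by linarith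
next
  assume "0 \<le> i \<and> i \<le> int m"
  then have "int m - 2 * i = - int m + 2 * int (m - nat i)" "m - nat i \<in> {..m}" by auto
  then show "int m - 2 * i \<in> weights m" unfolding weights_def by blast
qed

lemma weights_alt: "weights m = (\<lambda>i. int m - 2 * int i) ` {..m}"
proof
  show "(\<lambda>i. int m - 2 * int i) ` {..m} \<subseteq> weights m"
    by (auto simp: weights_iff)
  show "weights m \<subseteq> (\<lambda>i. int m - 2 * int i) ` {..m}"
  proof
    fix w assume "w \<in> weights m"
    then obtain j where "j \<le> m" "w = - int m + 2 * int j" by (auto simp: weights_def)
    then have "w = int m - 2 * int (m - j)" "m - j \<in> {..m}" by auto
    then show "w \<in> (\<lambda>i. int m - 2 * int i) ` {..m}" by blast
  qed
qed

lemma e_vec_zero: "\<not> (0 \<le> i \<and> i \<le> int m) \<Longrightarrow> e_vec m (int m - 2 * i) = 0"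
  by (auto simp: e_vec_def weights_iff)

lemma sum_lookup_e_vec:
  fixes g :: "nat \<Rightarrow> int \<Rightarrow>\<^sub>0 real"
  shows "(\<Sum>j\<le>m. Poly_Mapping.lookup (e_vec m (int m - 2 * i)) (int m - 2 * int j) *\<^sub>R g j) =
   (if 0 \<le> i \<and> i \<le> int m then g (nat i) else 0)"
proof (cases "0 \<le> i \<and> i \<le> int m")
  case True
  have "(\<Sum>j\<le>m. Poly_Mapping.lookup (e_vec m (int m - 2 * i)) (int m - 2 * int j) *\<^sub>R g j) =
        (\<Sum>j\<le>m. if nat i = j then g j else 0)"
    using True by (intro sum.cong) (auto simp: e_vec_def weights_iff lookup_single when_def)
  with True show ?thesis by auto
next
  case False
  have "(\<Sum>j\<le>m. Poly_Mapping.lookup (e_vec m (int m - 2 * i)) (int m - 2 * int j) *\<^sub>R g j) = 0"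
    unfolding e_vec_zero[OF False] by simp
  with False show ?thesis by (simp only: if_False)
qed

lemma irrep_H_e:
  assumes "i \<le> m"
  shows "irrep_H m (e_vec m (int m - 2 * int i)) =
    (real m - 2 * real i) *\<^sub>R e_vec m (int m - 2 * int i)"
  unfolding irrep_H_def sum_lookup_e_vec using assms by simp

lemma irrep_Y_e:
  assumes "i \<le> m"
  shows "irrep_Y m (e_vec m (int m - 2 * int i)) = e_vec m (int m - 2 * (int i + 1))"
  unfolding irrep_Y_def sum_lookup_e_vec using assms by simp

lemma irrep_X_e:
  assumes "i \<le> m"
  shows "irrep_X m (e_vec m (int m - 2 * int i)) =
    (real i * (real m - real i + 1)) *\<^sub>R e_vec m (int m - 2 * (int i - 1))"
  unfolding irrep_X_def sum_lookup_e_vec using assms by simp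

lemma linear_irrep_HYX: "linear (irrep_H m)" "linear (irrep_Y m)" "linear (irrep_X m)"
  by (auto intro!: linearI simp: irrep_H_def irrep_Y_def irrep_X_def lookup_add lookup_scaleR
      scaleR_add_left scaleR_sum_right mult.assoc distrib_right simp flip: sum.distrib)

lemma linear_irrep: "linear (irrep m A)"
  unfolding irrep_def[abs_def] by (intro linear_compose_add linear_compose_scale_right linear_irrep_HYX)

lemma irrep_basis:
  "irrep m sl2_X = irrep_X m" "irrep m sl2_Y = irrep_Y m" "irrep m sl2_H = irrep_H m"
  by (simp_all add: fun_eq_iff irrep_def sl2_defs)

lemma e_vec_in: "e_vec m w \<in> irrep_space m"
proof (cases "w \<in> weights m")
  case True
  then show ?thesis unfolding irrep_space_def by (intro span_base imageI)
next
  case False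
  then show ?thesis by (simp add: irrep_space_def e_vec_def span_zero)
qed

lemma subspace_irrep_space: "subspace (irrep_space m)"
  by (simp add: irrep_space_def)

lemma irrep_closed: "irrep m A v \<in> irrep_space m"
  unfolding irrep_def irrep_X_def irrep_Y_def irrep_H_def
  by (intro subspace_add subspace_scale subspace_sum subspace_irrep_space e_vec_in)

lemma irrep_eqI:
  assumes "linear f" "linear g" "v \<in> irrep_space m"
    and "\<And>i. i \<le> m \<Longrightarrow> f (e_vec m (int m - 2 * int i)) = g (e_vec m (int m - 2 * int i))"
  shows "f v = g v"
proof (rule linear_eq_on_span[OF assms(1,2)])
  show "v \<in> span (e_vec m ` weights m)" using assms(3) by (simp add: irrep_space_def)
  show "\<And>x. x \<in> e_vec m ` weights m \<Longrightarrow> f x = g x"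
    using assms(4) by (auto simp: weights_alt)
qed

lemma irrep_relations:
  assumes v: "v \<in> irrep_space m"
  shows "irrep_X m (irrep_Y m v) - irrep_Y m (irrep_X m v) = irrep_H m v"
    and "irrep_H m (irrep_X m v) - irrep_X m (irrep_H m v) = 2 *\<^sub>R irrep_X m v"
    and "irrep_H m (irrep_Y m v) - irrep_Y m (irrep_H m v) = - 2 *\<^sub>R irrep_Y m v"
proof -
  note L = linear_irrep_HYX[of m]
  note lin = L linear_compose[OF L(2,3), unfolded o_def] linear_compose[OF L(3,2), unfolded o_def]
    linear_compose[OF L(1,3), unfolded o_def] linear_compose[OF L(3,1), unfolded o_def]
    linear_compose[OF L(1,2), unfolded o_def] linear_compose[OF L(2,1), unfolded o_def]
  note sc = linear_scale[OF linear_irrep_HYX(1)] linear_scale[OF linear_irrep_HYX(2)]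
    linear_scale[OF linear_irrep_HYX(3)] linear_0[OF linear_irrep_HYX(1)]
    linear_0[OF linear_irrep_HYX(2)] linear_0[OF linear_irrep_HYX(3)]
  have XY: "irrep_X m (e_vec m (int m - 2 * (int i + 1))) =
      (real (i + 1) * (real m - real i)) *\<^sub>R e_vec m (int m - 2 * int i)" if "i \<le> m" for i
  proof (cases "i = m")
    case True
    then show ?thesis using e_vec_zero[of "int i + 1" m] by (simp add: sc)
  next
    case False
    then show ?thesis using irrep_X_e[of "Suc i" m] that by (simp add: add.commute)
  qed
  have YX: "real i *\<^sub>R irrep_Y m (e_vec m (int m - 2 * (int i - 1))) =
      real i *\<^sub>R e_vec m (int m - 2 * int i)" if "i \<le> m" for i
    using irrep_Y_e[of "i - 1" m] that by (cases i) (auto simp: algebra_simps)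
  have HX: "real i *\<^sub>R irrep_H m (e_vec m (int m - 2 * (int i - 1))) =
      (real i * (real m - 2 * real i + 2)) *\<^sub>R e_vec m (int m - 2 * (int i - 1))" if "i \<le> m" for i
    using irrep_H_e[of "i - 1" m] that by (cases i) auto
  have HY: "irrep_H m (e_vec m (int m - 2 * (int i + 1))) =
      (real m - 2 * real i - 2) *\<^sub>R e_vec m (int m - 2 * (int i + 1))" if "i \<le> m" for i
  proof (cases "i = m")
    case True
    then show ?thesis using e_vec_zero[of "int i + 1" m] by (simp add: sc)
  next
    case False
    then show ?thesis using irrep_H_e[of "Suc i" m] that by (simp add: add.commute algebra_simps)
  qed
  show "irrep_X m (irrep_Y m v) - irrep_Y m (irrep_X m v) = irrep_H m v"
  proof (rule irrep_eqI[OF _ _ v])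
    fix i assume i: "i \<le> m"
    have "irrep_Y m (irrep_X m (e_vec m (int m - 2 * int i))) =
        (real m - real i + 1) *\<^sub>R real i *\<^sub>R irrep_Y m (e_vec m (int m - 2 * (int i - 1)))"
      by (simp add: irrep_X_e[OF i] sc)
    also have "\<dots> = ((real m - real i + 1) * real i) *\<^sub>R e_vec m (int m - 2 * int i)"
      unfolding YX[OF i] by simp
    finally show "irrep_X m (irrep_Y m (e_vec m (int m - 2 * int i))) -
        irrep_Y m (irrep_X m (e_vec m (int m - 2 * int i))) =
        irrep_H m (e_vec m (int m - 2 * int i))"
      unfolding irrep_Y_e[OF i] irrep_H_e[OF i] XY[OF i]
      by (simp only: flip: scaleR_diff_left, intro arg_cong2[where f = scaleR] refl)
        (simp add: algebra_simps)
  qed (rule lin linear_compose_sub)+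
  show "irrep_H m (irrep_X m v) - irrep_X m (irrep_H m v) = 2 *\<^sub>R irrep_X m v"
  proof (rule irrep_eqI[OF _ _ v])
    fix i assume i: "i \<le> m"
    have "irrep_H m (irrep_X m (e_vec m (int m - 2 * int i))) =
        (real m - real i + 1) *\<^sub>R real i *\<^sub>R irrep_H m (e_vec m (int m - 2 * (int i - 1)))"
      by (simp add: irrep_X_e[OF i] sc)
    also have "\<dots> = ((real m - real i + 1) * (real i * (real m - 2 * real i + 2))) *\<^sub>R
        e_vec m (int m - 2 * (int i - 1))"
      unfolding HX[OF i] by simp
    finally show "irrep_H m (irrep_X m (e_vec m (int m - 2 * int i))) -
        irrep_X m (irrep_H m (e_vec m (int m - 2 * int i))) =
        2 *\<^sub>R irrep_X m (e_vec m (int m - 2 * int i))"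
      unfolding irrep_H_e[OF i] sc unfolding irrep_X_e[OF i] scaleR_scaleR
      by (simp only: flip: scaleR_diff_left, intro arg_cong2[where f = scaleR] refl)
        (simp add: algebra_simps)
  qed (rule lin linear_compose_sub linear_compose_scale_right)+
  show "irrep_H m (irrep_Y m v) - irrep_Y m (irrep_H m v) = - 2 *\<^sub>R irrep_Y m v"
  proof (rule irrep_eqI[OF _ _ v])
    fix i assume i: "i \<le> m"
    show "irrep_H m (irrep_Y m (e_vec m (int m - 2 * int i))) -
        irrep_Y m (irrep_H m (e_vec m (int m - 2 * int i))) =
        - 2 *\<^sub>R irrep_Y m (e_vec m (int m - 2 * int i))"
      unfolding irrep_H_e[OF i] sc unfolding irrep_Y_e[OF i] HY[OF i] scaleR_scaleR
      by (simp only: flip: scaleR_diff_left, intro arg_cong2[where f = scaleR] refl)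
        (simp add: algebra_simps)
  qed (rule lin linear_compose_sub linear_compose_scale_right)+
qed

lemma bracket_coords:
  assumes "A \<in> sl2" "B \<in> sl2"
  shows "bracket A B $ 1 $ 2 = 2 * (A$1$1 * B$1$2 - B$1$1 * A$1$2)"
    and "bracket A B $ 2 $ 1 = - 2 * (A$1$1 * B$2$1 - B$1$1 * A$2$1)"
    and "bracket A B $ 1 $ 1 = A$1$2 * B$2$1 - B$1$2 * A$2$1"
proof -
  have "A$2$2 = - A$1$1" "B$2$2 = - B$1$1"
    using assms by (auto simp: sl2_def trace_def sum_2)
  then show "bracket A B $ 1 $ 2 = 2 * (A$1$1 * B$1$2 - B$1$1 * A$1$2)"
    "bracket A B $ 2 $ 1 = - 2 * (A$1$1 * B$2$1 - B$1$1 * A$2$1)"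
    "bracket A B $ 1 $ 1 = A$1$2 * B$2$1 - B$1$2 * A$2$1"
    by (simp_all add: bracket_def matrix_matrix_mult_def sum_2 algebra_simps)
qed

lemma sl2_rep_irrep: "sl2_rep (irrep_space m) (irrep m)"
proof -
  have br: "irrep m (bracket A B) v = irrep m A (irrep m B v) - irrep m B (irrep m A v)"
    if A: "A \<in> sl2" and B: "B \<in> sl2" and v: "v \<in> irrep_space m" for A B v
  proof -
    note r = irrep_relations[OF v, unfolded diff_eq_eq]
    note l = linear_add[OF linear_irrep_HYX(1)] linear_add[OF linear_irrep_HYX(2)]
      linear_add[OF linear_irrep_HYX(3)] linear_scale[OF linear_irrep_HYX(1)]
      linear_scale[OF linear_irrep_HYX(2)] linear_scale[OF linear_irrep_HYX(3)]
    show ?thesis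
      by (simp only: irrep_def bracket_coords[OF A B] l r scaleR_add_right scaleR_scaleR)
        (simp add: algebra_simps)
  qed
  have "linear_on sl2 (\<lambda>A. irrep m A v)" for v
    by (simp add: linear_on_def irrep_def algebra_simps)
  moreover have "linear_on (irrep_space m) (irrep m A)" for A
    by (simp add: linear_on_def linear_add[OF linear_irrep] linear_scale[OF linear_irrep])
  ultimately show ?thesis
    using br irrep_closed by (auto simp: sl2_rep_def subspace_irrep_space)
qed

lemma e_vec_inj: "inj_on (e_vec m) (weights m)"
  by (rule inj_onI) (auto simp: e_vec_def dest!: arg_cong[where f = Poly_Mapping.keys])

lemma independent_e_vec: "independent (e_vec m ` weights m)"
proof -
  have fin: "finite (weights m)" by (simp add: weights_def)
  have "u v = 0" if s: "(\<Sum>v\<in>e_vec m ` weights m. u v *\<^sub>R v) = 0" and v: "v \<in> e_vec m ` weights m"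
    for u v
  proof -
    obtain w where w: "w \<in> weights m" "v = e_vec m w" using v by blast
    have "(\<Sum>x\<in>weights m. u (e_vec m x) *\<^sub>R e_vec m x) = 0"
      using s by (simp add: sum.reindex[OF e_vec_inj])
    then have "Poly_Mapping.lookup (\<Sum>x\<in>weights m. u (e_vec m x) *\<^sub>R e_vec m x) w = 0" by simp
    then have "(\<Sum>x\<in>weights m. if w = x then u (e_vec m x) else 0) = 0"
      unfolding lookup_sum lookup_scaleR
      by (subst (asm) sum.cong[where h = "\<lambda>x. if w = x then u (e_vec m x) else 0", OF refl])
        (auto simp: e_vec_def lookup_single when_def)
    with w fin show "u v = 0" by (simp add: sum.delta')
  qed
  then show ?thesis
    using fin by (simp add: independent_explicit_finite_subsets independent_if_scalars_zero)
qed

lemma dim_irrep_space: "dim (irrep_space m) = m + 1"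
proof -
  have "dim (irrep_space m) = card (weights m)"
    by (simp add: irrep_space_def dim_eq_card_independent[OF independent_e_vec]
        card_image[OF e_vec_inj])
  also have "\<dots> = m + 1"
    unfolding weights_def by (subst card_image) (auto intro: inj_onI)
  finally show ?thesis .
qed

lemma expand_single:
  fixes v :: "'a \<Rightarrow>\<^sub>0 real"
  assumes "finite S" "Poly_Mapping.keys v \<subseteq> S"
  shows "v = (\<Sum>p\<in>S. Poly_Mapping.lookup v p *\<^sub>R Poly_Mapping.single p 1)"
proof (rule poly_mapping_eqI)
  fix k
  have "Poly_Mapping.lookup (\<Sum>p\<in>S. Poly_Mapping.lookup v p *\<^sub>R Poly_Mapping.single p (1::real)) k
      = (\<Sum>p\<in>S. if k = p then Poly_Mapping.lookup v p else 0)"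
    unfolding lookup_sum lookup_scaleR by (rule sum.cong) (auto simp: lookup_single when_def)
  also have "\<dots> = Poly_Mapping.lookup v k"
    using assms by (auto simp: in_keys_iff)
  finally show "Poly_Mapping.lookup v k =
      Poly_Mapping.lookup (\<Sum>p\<in>S. Poly_Mapping.lookup v p *\<^sub>R Poly_Mapping.single p (1::real)) k" ..
qed

lemma lookup_tensor [simp]:
  "Poly_Mapping.lookup (tensor u v) (p, q) = Poly_Mapping.lookup u p * Poly_Mapping.lookup v q"
proof -
  have "Poly_Mapping.lookup (tensor u v) (p, q) =
     (\<Sum>p'\<in>Poly_Mapping.keys u. \<Sum>q'\<in>Poly_Mapping.keys v.
       if p' = p \<and> q' = q then Poly_Mapping.lookup u p' * Poly_Mapping.lookup v q' else 0)"
    unfolding tensor_def lookup_sum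
    by (intro sum.cong refl) (auto simp: lookup_single when_def)
  also have "\<dots> = (\<Sum>p'\<in>Poly_Mapping.keys u.
       if p' = p then Poly_Mapping.lookup u p' * Poly_Mapping.lookup v q else 0)"
    by (intro sum.cong refl) (auto simp: in_keys_iff)
  also have "\<dots> = Poly_Mapping.lookup u p * Poly_Mapping.lookup v q"
    by (auto simp: in_keys_iff)
  finally show ?thesis .
qed

lemma keys_tensor: "Poly_Mapping.keys (tensor u v) = Poly_Mapping.keys u \<times> Poly_Mapping.keys v"
  by (auto simp: in_keys_iff)

lemma linear_tensor_left: "linear (\<lambda>u. tensor u v)"
  by (rule linearI; rule poly_mapping_eqI)
    (auto simp: lookup_add lookup_scaleR algebra_simps split_paired_all)

lemma linear_tensor_right: "linear (tensor u)"
  by (rule linearI; rule poly_mapping_eqI)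
    (auto simp: lookup_add lookup_scaleR algebra_simps split_paired_all)

lemma tensor_rep_superset:
  assumes "finite S" "Poly_Mapping.keys t \<subseteq> S"
  shows "tensor_rep \<rho> \<sigma> A t = (\<Sum>(p, q)\<in>S. Poly_Mapping.lookup t (p, q) *\<^sub>R
     (tensor (\<rho> A (Poly_Mapping.single p 1)) (Poly_Mapping.single q 1) +
      tensor (Poly_Mapping.single p 1) (\<sigma> A (Poly_Mapping.single q 1))))"
  unfolding tensor_rep_def by (rule sum.mono_neutral_left) (use assms in \<open>auto simp: in_keys_iff\<close>)

lemma linear_tensor_rep: "linear (tensor_rep \<rho> \<sigma> A)"
proof (rule linearI)
  fix s t :: "'a \<times> 'b \<Rightarrow>\<^sub>0 real" and c :: real
  let ?S = "Poly_Mapping.keys s \<union> Poly_Mapping.keys t"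
  have k: "finite ?S" "Poly_Mapping.keys s \<subseteq> ?S" "Poly_Mapping.keys t \<subseteq> ?S"
    "Poly_Mapping.keys (s + t) \<subseteq> ?S" "Poly_Mapping.keys (c *\<^sub>R s) \<subseteq> ?S"
    by (auto simp: in_keys_iff lookup_add lookup_scaleR)
  show "tensor_rep \<rho> \<sigma> A (s + t) = tensor_rep \<rho> \<sigma> A s + tensor_rep \<rho> \<sigma> A t"
    unfolding tensor_rep_superset[OF k(1,2)] tensor_rep_superset[OF k(1,3)]
      tensor_rep_superset[OF k(1,4)] sum.distrib[symmetric]
    by (rule sum.cong) (auto simp: lookup_add scaleR_add_left)
  show "tensor_rep \<rho> \<sigma> A (c *\<^sub>R s) = c *\<^sub>R tensor_rep \<rho> \<sigma> A s"
    unfolding tensor_rep_superset[OF k(1,2)] tensor_rep_superset[OF k(1,5)] scaleR_sum_right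
    by (rule sum.cong) (auto simp: lookup_scaleR)
qed

lemma tensor_rep_tensor:
  assumes \<rho>: "linear (\<rho> A)" and \<sigma>: "linear (\<sigma> A)"
  shows "tensor_rep \<rho> \<sigma> A (tensor u v) = tensor (\<rho> A u) v + tensor u (\<sigma> A v)"
proof -
  let ?s = "\<lambda>p. Poly_Mapping.single p (1::real)"
  let ?l = "Poly_Mapping.lookup" and ?K = "Poly_Mapping.keys u" and ?L = "Poly_Mapping.keys v"
  have u: "u = (\<Sum>p\<in>?K. ?l u p *\<^sub>R ?s p)" and v: "v = (\<Sum>q\<in>?L. ?l v q *\<^sub>R ?s q)"
    by (simp_all add: expand_single[symmetric])
  have bil: "f u v = (\<Sum>p\<in>?K. \<Sum>q\<in>?L. (?l u p * ?l v q) *\<^sub>R f (?s p) (?s q))"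
    if "\<And>v. linear (\<lambda>u. f u v)" "\<And>u. linear (f u)" for f :: "_ \<Rightarrow> _ \<Rightarrow> ('a \<times> 'b \<Rightarrow>\<^sub>0 real)"
  proof -
    have "f u v = (\<Sum>p\<in>?K. ?l u p *\<^sub>R f (?s p) v)"
      by (subst u) (simp only: linear_sum[OF that(1)] linear_scale[OF that(1)])
    also have "\<dots> = (\<Sum>p\<in>?K. ?l u p *\<^sub>R (\<Sum>q\<in>?L. ?l v q *\<^sub>R f (?s p) (?s q)))"
      by (subst v) (simp only: linear_sum[OF that(2)] linear_scale[OF that(2)])
    finally show ?thesis by (simp only: scaleR_sum_right scaleR_scaleR)
  qed
  note cmp = linear_compose[OF \<rho> linear_tensor_left, unfolded o_def]
    linear_compose[OF \<sigma> linear_tensor_right, unfolded o_def]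
  have "tensor_rep \<rho> \<sigma> A (tensor u v) = (\<Sum>p\<in>?K. \<Sum>q\<in>?L. (?l u p * ?l v q) *\<^sub>R
      (tensor (\<rho> A (?s p)) (?s q) + tensor (?s p) (\<sigma> A (?s q))))"
    by (simp add: tensor_rep_def keys_tensor sum.cartesian_product)
  also have "\<dots> = tensor (\<rho> A u) v + tensor u (\<sigma> A v)"
    by (rule bil[symmetric])
      (intro linear_compose_add linear_tensor_left linear_tensor_right cmp)+
  finally show ?thesis .
qed

lemma keys_irrep_space: "v \<in> irrep_space m \<Longrightarrow> Poly_Mapping.keys v \<subseteq> weights m"
  unfolding irrep_space_def
proof (induction rule: span_induct_alt)
  case base
  then show ?case by simp
next
  case (step c x y)
  then have "Poly_Mapping.keys x \<subseteq> weights m" by (auto simp: e_vec_def)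
  moreover have "Poly_Mapping.keys (c *\<^sub>R x + y) \<subseteq> Poly_Mapping.keys x \<union> Poly_Mapping.keys y"
    by (auto simp: in_keys_iff lookup_add lookup_scaleR)
  ultimately show ?case using step by blast
qed

lemma linear_on_sum:
  assumes "linear_on V f" "subspace V" "finite S" "\<And>p. p \<in> S \<Longrightarrow> g p \<in> V"
  shows "f (\<Sum>p\<in>S. c p *\<^sub>R g p) = (\<Sum>p\<in>S. c p *\<^sub>R f (g p))"
  using assms(3,4)
proof (induction S rule: finite_induct)
  case empty
  have "f (0 *\<^sub>R 0) = 0 *\<^sub>R f 0"
    using assms(1) subspace_0[OF assms(2)] unfolding linear_on_def by blast
  then show ?case by simp
next
  case (insert x F)
  then have "(\<Sum>p\<in>F. c p *\<^sub>R g p) \<in> V" "c x *\<^sub>R g x \<in> V" "g x \<in> V"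
    using assms(2) by (auto intro!: subspace_sum subspace_scale)
  then show ?case using insert assms(1) by (simp add: linear_on_def)
qed

lemma bilinear_on_irrep_expand:
  assumes Q: "bilinear_on (irrep_space m) Q" and u: "u \<in> irrep_space m" and v: "v \<in> irrep_space m"
  shows "Q u v = (\<Sum>p\<in>Poly_Mapping.keys u. \<Sum>p'\<in>Poly_Mapping.keys v.
    Poly_Mapping.lookup u p * Poly_Mapping.lookup v p' *
    Q (Poly_Mapping.single p 1) (Poly_Mapping.single p' 1))"
proof -
  let ?s = "\<lambda>p. Poly_Mapping.single p (1::real)"
  have s: "?s p \<in> irrep_space m" if "p \<in> weights m" for p
    using e_vec_in[of m p] that by (simp add: e_vec_def)
  note sub = subspace_irrep_space
  have "Q u v = (\<lambda>x. Q x v) (\<Sum>p\<in>Poly_Mapping.keys u. Poly_Mapping.lookup u p *\<^sub>R ?s p)"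
    by (simp add: expand_single[symmetric])
  also have "\<dots> = (\<Sum>p\<in>Poly_Mapping.keys u. Poly_Mapping.lookup u p *\<^sub>R Q (?s p) v)"
    by (rule linear_on_sum[OF _ sub])
      (use Q v s keys_irrep_space[OF u] in \<open>auto simp: bilinear_on_def\<close>)
  also have "\<dots> = (\<Sum>p\<in>Poly_Mapping.keys u. Poly_Mapping.lookup u p *\<^sub>R
      (\<Sum>p'\<in>Poly_Mapping.keys v. Poly_Mapping.lookup v p' *\<^sub>R Q (?s p) (?s p')))"
  proof (intro sum.cong refl arg_cong2[where f = scaleR])
    fix p assume p: "p \<in> Poly_Mapping.keys u"
    have "Q (?s p) v = Q (?s p) (\<Sum>p'\<in>Poly_Mapping.keys v. Poly_Mapping.lookup v p' *\<^sub>R ?s p')"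
      by (simp add: expand_single[symmetric])
    also have "\<dots> = (\<Sum>p'\<in>Poly_Mapping.keys v. Poly_Mapping.lookup v p' *\<^sub>R Q (?s p) (?s p'))"
      by (rule linear_on_sum[OF _ sub])
        (use Q p s keys_irrep_space[OF u] keys_irrep_space[OF v] in \<open>auto simp: bilinear_on_def\<close>)
    finally show "Q (?s p) v =
      (\<Sum>p'\<in>Poly_Mapping.keys v. Poly_Mapping.lookup v p' *\<^sub>R Q (?s p) (?s p'))" .
  qed
  finally show ?thesis by (simp add: sum_distrib_left mult.assoc)
qed

lemma tensor_form_tensor:
  assumes Q: "bilinear_on (irrep_space m) Q" and R: "bilinear_on (irrep_space n) R"
    and "u \<in> irrep_space m" "u' \<in> irrep_space m" "v \<in> irrep_space n" "v' \<in> irrep_space n"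
  shows "tensor_form Q R (tensor u v) (tensor u' v') = Q u u' * R v v'"
proof -
  have swap: "sum g K = sum h K" if "\<And>p. g p = h p" for g h :: "int \<Rightarrow> real" and K
    using that by simp
  let ?s = "\<lambda>p. Poly_Mapping.single p (1::real)" and ?l = "Poly_Mapping.lookup"
  let ?k = "Poly_Mapping.keys"
  have "tensor_form Q R (tensor u v) (tensor u' v') =
    (\<Sum>p\<in>?k u. \<Sum>q\<in>Poly_Mapping.keys v. \<Sum>p'\<in>?k u'. \<Sum>q'\<in>Poly_Mapping.keys v'.
      (?l u p * ?l u' p' * Q (?s p) (?s p')) *
      (Poly_Mapping.lookup v q * Poly_Mapping.lookup v' q' *
        R (Poly_Mapping.single q 1) (Poly_Mapping.single q' 1)))"
    by (simp add: tensor_form_def keys_tensor sum.cartesian_product[symmetric] mult_ac)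
  also have "\<dots> = (\<Sum>p\<in>?k u. \<Sum>p'\<in>?k u'. \<Sum>q\<in>Poly_Mapping.keys v. \<Sum>q'\<in>Poly_Mapping.keys v'.
      (?l u p * ?l u' p' * Q (?s p) (?s p')) *
      (Poly_Mapping.lookup v q * Poly_Mapping.lookup v' q' *
        R (Poly_Mapping.single q 1) (Poly_Mapping.single q' 1)))"
    by (rule swap, rule sum.swap)
  also have "\<dots> = Q u u' * R v v'"
    unfolding bilinear_on_irrep_expand[OF Q assms(3,4)] bilinear_on_irrep_expand[OF R assms(5,6)]
    unfolding sum_distrib_right unfolding sum_distrib_left by (rule refl)
  finally show ?thesis .
qed

end

theory Submission
  imports Defs
begin

text \<open>
  Counted from the lowest weight, write \<open>f\<^sub>0, \<dots>, f\<^sub>m\<close> and \<open>g\<^sub>0, \<dots>, g\<^sub>n\<close> for the weight bases of the two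
  representations. Invariance leaves little freedom for \<open>Q\<close>: it pairs \<open>f\<^sub>i\<close> only with
  \<open>f\<^bsub>m-i\<^esub>\<close>, and the value is one nonzero constant \<open>c\<close> for all \<open>i\<close> (\<open>star_form_low_vec\<close>,
  \<open>star_form_const_nonzero\<close>). Likewise \<open>R\<close> is governed by a nonzero constant \<open>d\<close>.

  Every lowest weight vector of weight \<open>-m - n + 2k\<close> is a multiple of the alternating sum \<open>w\<close> of
  the tensors \<open>f\<^sub>i \<otimes> g\<^bsub>k-i\<^esub>\<close> (\<open>P_space_multiple\<close>), so everything comes down to the sign of
  \<open>\<omega>\<^sub>k(w, w)\<close>. This is a double alternating sum over \<open>i\<close> and \<open>j\<close> of the pairings of
  \<open>f\<^sub>i \<otimes> g\<^bsub>k-i\<^esub>\<close> with \<open>X\<^bsup>m+n-2k\<^esup> (f\<^sub>j \<otimes> g\<^bsub>k-j\<^esub>)\<close>. Each pairing is \<open>c * d\<close> times a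
  positive factor depending on \<open>i\<close>, times \<open>k choose j\<close>, times a polynomial in \<open>j\<close> of degree \<open>k\<close>
  whose leading coefficient has sign \<open>(-1)\<^sup>i\<close> (\<open>tensor_pairing_X_pow\<close>). The alternating sum over \<open>j\<close>
  is therefore a \<open>k\<close>-th finite difference, which sees only the leading coefficient (\<open>alternating_binomial_sum\<close>).
  It yields the sign \<open>(-1)\<^sup>k (-1)\<^sup>i\<close>; the factor \<open>(-1)\<^sup>i\<close> cancels
  against the coefficient of \<open>f\<^sub>i \<otimes> g\<^bsub>k-i\<^esub>\<close> in \<open>w\<close>, and the remaining sum over \<open>i\<close> has positive terms
  (\<open>omega_lowest_weight_vec\<close>). Hence \<open>\<omega>\<^sub>k\<close> is definite of sign \<open>(-1)\<^sup>k\<close> times the sign of \<open>c * d\<close>.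
\<close>

section \<open>An alternating sum of binomial products\<close>

text \<open>As a function of \<open>j\<close>, the product \<open>((m - j) choose i) * ((M + j) choose l)\<close> is a polynomial of
  degree \<open>i + l = k\<close> with leading coefficient \<open>(-1) ^ i / (fact i * fact l)\<close>, and the sum is, up to the
  sign \<open>(-1) ^ k\<close>, its \<open>k\<close>-th finite difference, hence \<open>fact k\<close> times that coefficient. The
  proof takes one difference at a time: by Pascal's rule a difference of such a product is a
  combination of two products of the same shape with \<open>i + l\<close> lowered by one. The bound \<open>k \<le> m\<close>
  makes the truncated subtraction \<open>m - j\<close> exact.
\<close>

lemma alternating_binomial_sum:
  assumes "i + l = k" "k \<le> m"
  shows "(\<Sum>j\<le>k. (-1) ^ j * real (k choose j) * real ((m - j) choose i) * real ((M + j) choose l))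
         = (-1) ^ l * real (k choose i)"
  using assms
proof (induction k arbitrary: i l m)
  case 0
  then show ?case by simp
next
  case (Suc k)
  define f where "f j = real ((m - j) choose i) * real ((M + j) choose l)" for j
  obtain m' where m': "m = Suc m'" "k \<le> m'" using Suc.prems by (cases m) auto
  have "(\<Sum>j\<le>Suc k. (-1) ^ j * real (Suc k choose j) * f j)
      = f 0 + (\<Sum>j\<le>k. (-1) ^ Suc j * real ((k choose j) + (k choose Suc j)) * f (Suc j))"
    by (simp only: sum.atMost_Suc_shift binomial_Suc_Suc) (simp add: add.commute)
  also have "\<dots> = f 0 + (\<Sum>j\<le>k. (-1) ^ Suc j * real (k choose Suc j) * f (Suc j))
      - (\<Sum>j\<le>k. (-1) ^ j * real (k choose j) * f (Suc j))"
    by (simp add: algebra_simps sum.distrib sum_negf sum_subtractf)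
  also have "f 0 + (\<Sum>j\<le>k. (-1) ^ Suc j * real (k choose Suc j) * f (Suc j))
      = (\<Sum>j\<le>Suc k. (-1) ^ j * real (k choose j) * f j)"
    by (simp only: sum.atMost_Suc_shift) simp
  (* The alternating sum of order k + 1 is that of order k, taken of the difference of f. *)
  finally have diff: "(\<Sum>j\<le>Suc k. (-1) ^ j * real (Suc k choose j) * f j)
      = (\<Sum>j\<le>k. (-1) ^ j * real (k choose j) * (f j - f (Suc j)))"
    by (simp add: right_diff_distrib sum_subtractf)
  have sub: "m - j = Suc (m' - j)" "m - Suc j = m' - j" if "j \<le> k" for j
    using that m' by auto
  define T where "T i l = (\<Sum>j\<le>k. (-1) ^ j * real (k choose j) *
      real ((m' - j) choose i) * real ((M + j) choose l))" for i l
  have eq: "(\<Sum>j\<le>k. (-1) ^ j * real (k choose j) * (f j - f (Suc j)))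
      = (if i = 0 then 0 else T (i - 1) l) - (if l = 0 then 0 else T i (l - 1))"
  proof -
    have "f j - f (Suc j) =
        (if i = 0 then 0 else real ((m' - j) choose (i - 1)) * real ((M + j) choose l)) -
        (if l = 0 then 0 else real ((m' - j) choose i) * real ((M + j) choose (l - 1)))"
      if "j \<le> k" for j
      unfolding f_def sub[OF that] by (cases i; cases l) (simp_all add: algebra_simps)
    then have "(\<Sum>j\<le>k. (-1) ^ j * real (k choose j) * (f j - f (Suc j)))
      = (\<Sum>j\<le>k. (-1) ^ j * real (k choose j) *
        ((if i = 0 then 0 else real ((m' - j) choose (i - 1)) * real ((M + j) choose l)) -
        (if l = 0 then 0 else real ((m' - j) choose i) * real ((M + j) choose (l - 1)))))"
      by (intro sum.cong) auto
    then show ?thesis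
      by (auto simp: T_def right_diff_distrib sum_subtractf sum_negf mult.assoc)
  qed
  have IH: "T a b = (-1) ^ b * real (k choose a)" if "a + b = k" for a b
    unfolding T_def by (rule Suc.IH[OF that m'(2)])
  have "(\<Sum>j\<le>Suc k. (-1) ^ j * real (Suc k choose j) * f j) = (-1) ^ l * real (Suc k choose i)"
    unfolding diff eq using Suc.prems IH[of "i - 1" l] IH[of i "l - 1"]
    by (cases i; cases l) (simp_all add: algebra_simps binomial_eq_0)
  then show ?case by (simp add: f_def mult.assoc)
qed

section \<open>The irreducible representations counted from the lowest weight\<close>

text \<open>Counting from the lowest weight makes the indices of the two factors of a weight vector in the
  tensor product add up to \<open>k\<close>, with no reference to \<open>m\<close> and \<open>n\<close>. Indices above \<open>m\<close> give \<open>0\<close>, so that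
  the action of \<open>X\<close> needs no case distinction at the top.\<close>

definition low_vec :: "nat \<Rightarrow> nat \<Rightarrow> int \<Rightarrow>\<^sub>0 real" where
  "low_vec m i = e_vec m (2 * int i - int m)"

lemma low_vec_eq: "low_vec m i = e_vec m (int m - 2 * (int m - int i))"
  by (simp add: low_vec_def)

lemma low_vec_zero: "m < i \<Longrightarrow> low_vec m i = 0"
  unfolding low_vec_eq by (rule e_vec_zero) simp

lemma weights_low: "weights m = (\<lambda>i. 2 * int i - int m) ` {..m}"
  by (simp add: weights_def algebra_simps)

lemma low_vec_single: "i \<le> m \<Longrightarrow> low_vec m i = Poly_Mapping.single (2 * int i - int m) 1"
  by (auto simp: low_vec_def e_vec_def weights_low)

lemma low_vec_in: "low_vec m i \<in> irrep_space m"
  by (simp add: low_vec_def e_vec_in)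

lemma lookup_low_vec:
  "Poly_Mapping.lookup (low_vec m i) (2 * int j - int m) = (if i = j \<and> i \<le> m then 1 else 0)"
  by (cases "i \<le> m") (auto simp: low_vec_single low_vec_zero lookup_single when_def)

lemma irrep_space_span_low_vec: "irrep_space m = span (low_vec m ` {..m})"
  by (simp add: irrep_space_def weights_low image_image low_vec_def)

lemma irrep_H_low_vec:
  "irrep m sl2_H (low_vec m i) = (2 * real i - real m) *\<^sub>R low_vec m i"
proof (cases "i \<le> m")
  case True
  then show ?thesis
    using irrep_H_e[of "m - i" m] by (simp add: irrep_basis low_vec_def of_nat_diff)
qed (simp add: low_vec_zero linear_0[OF linear_irrep])

lemma irrep_Y_low_vec_0: "irrep m sl2_Y (low_vec m 0) = 0"
  using irrep_Y_e[of m m] e_vec_zero[of "int m + 1" m] by (simp add: irrep_basis low_vec_def)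

lemma irrep_Y_low_vec_Suc:
  assumes "Suc i \<le> m"
  shows "irrep m sl2_Y (low_vec m (Suc i)) = low_vec m i"
  using irrep_Y_e[of "m - Suc i" m] assms
  by (simp add: irrep_basis low_vec_def of_nat_diff algebra_simps)

lemma irrep_X_low_vec:
  "irrep m sl2_X (low_vec m i) = ((real m - real i) * (real i + 1)) *\<^sub>R low_vec m (Suc i)"
proof (cases "i \<le> m")
  case True
  then show ?thesis
    using irrep_X_e[of "m - i" m]
    by (simp add: irrep_basis low_vec_def of_nat_diff algebra_simps)
qed (simp add: low_vec_zero linear_0[OF linear_irrep])

text \<open>For \<open>i + a \<le> m\<close> the coefficient is the product of \<open>(m - i - t) * (i + t + 1)\<close> over \<open>t < a\<close>.
  For \<open>i + a > m\<close> the subtraction \<open>m - i - a\<close> is truncated and the coefficient is meaningless, but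
  both sides are \<open>0\<close> because the vector on the right is.\<close>

lemma irrep_X_pow_low_vec:
  assumes "i \<le> m"
  shows "(irrep m sl2_X ^^ a) (low_vec m i) =
    (fact (m - i) * fact (i + a) / (fact i * fact (m - i - a))) *\<^sub>R low_vec m (i + a)"
proof (induction a)
  case 0
  then show ?case by simp
next
  case (Suc a)
  show ?case
  proof (cases "i + a < m")
    case True
    define b where "b = m - i - Suc a"
    have b: "m - i - a = Suc b" "real m - real (i + a) = real (Suc b)"
      using True by (auto simp: b_def)
    have "(irrep m sl2_X ^^ Suc a) (low_vec m i) =
        (fact (m - i) * fact (i + a) / (fact i * fact (Suc b)) *
          (real (Suc b) * real (Suc (i + a)))) *\<^sub>R low_vec m (i + Suc a)"
      using Suc b by (simp add: linear_scale[OF linear_irrep] irrep_X_low_vec add_ac)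
    also have "fact (m - i) * fact (i + a) / (fact i * fact (Suc b)) *
          (real (Suc b) * real (Suc (i + a)))
        = (fact (m - i) * fact (i + Suc a) / (fact i * fact b) :: real)"
      by (simp add: divide_simps del: of_nat_Suc)
    finally show ?thesis unfolding b_def .
  next
    case False
    then have "low_vec m (i + Suc a) = 0" by (intro low_vec_zero) simp
    then show ?thesis using Suc by (simp add: linear_scale[OF linear_irrep] irrep_X_low_vec)
  qed
qed

section \<open>Invariant forms on the irreducible representations\<close>

text \<open>Since \<open>H\<close> is skew for the form, weights pair nontrivially only with their negatives. Since \<open>Y\<close>
  is self-adjoint, moving one \<open>Y\<close> across the form shows that all of these pairings are equal, so an
  invariant form is determined by one scalar and introduces no signs of its own.\<close>

lemma star_form_low_vec:
  assumes Q: "bilinear_on (irrep_space m) Q" and star: "star_rep (irrep_space m) (irrep m) Q"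
    and "i \<le> m" "j \<le> m"
  shows "Q (low_vec m i) (low_vec m j) = (if i + j = m then Q (low_vec m 0) (low_vec m m) else 0)"
proof -
  have adj: "Q (irrep m A u) v = Q u (irrep m (sl2_star A) v)"
    if "A \<in> sl2" "u \<in> irrep_space m" "v \<in> irrep_space m" for A u v
    using star that by (simp add: star_rep_def)
  have scL: "Q (c *\<^sub>R u) v = c * Q u v" and scR: "Q u (c *\<^sub>R v) = c * Q u v"
    if "u \<in> irrep_space m" "v \<in> irrep_space m" for c u v
    using Q that by (auto simp: bilinear_on_def linear_on_def)
  show ?thesis
  proof (cases "i + j = m")
    case True
    have "Q (low_vec m i) (low_vec m (m - i)) = Q (low_vec m 0) (low_vec m m)"
      using \<open>i \<le> m\<close>
    proof (induction i)
      case (Suc i)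
      have "Q (low_vec m (Suc i)) (low_vec m (m - Suc i))
          = Q (low_vec m (Suc i)) (irrep m sl2_Y (low_vec m (m - i)))"
        using irrep_Y_low_vec_Suc[of "m - Suc i" m] Suc.prems by (simp add: Suc_diff_Suc)
      also have "\<dots> = Q (irrep m sl2_Y (low_vec m (Suc i))) (low_vec m (m - i))"
        by (simp add: adj sl2_basis_mem low_vec_in sl2_star_basis)
      also have "\<dots> = Q (low_vec m i) (low_vec m (m - i))"
        using Suc.prems by (simp add: irrep_Y_low_vec_Suc)
      finally show ?case using Suc by simp
    qed simp
    with True show ?thesis by auto
  next
    case False
    have neg: "irrep m (- sl2_H) v = (-1) *\<^sub>R irrep m sl2_H v" for v
      by (simp add: irrep_def sl2_defs)
    have "(2 * real i - real m) * Q (low_vec m i) (low_vec m j)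
        = (-1) * ((2 * real j - real m) * Q (low_vec m i) (low_vec m j))"
      using adj[OF sl2_basis_mem(3) low_vec_in low_vec_in, of i j]
      by (simp only: sl2_star_basis neg irrep_H_low_vec scL scR low_vec_in scaleR_scaleR)
    then have "(real i + real j - real m) * Q (low_vec m i) (low_vec m j) = 0"
      by (simp add: algebra_simps)
    moreover have "real i + real j - real m \<noteq> 0" using False by linarith
    ultimately show ?thesis using False by simp
  qed
qed

text \<open>The lowest weight vector pairs to zero with every basis vector but the highest, so if this one
  pairing vanished as well, the form would be degenerate.\<close>

lemma star_form_const_nonzero:
  assumes Q: "bilinear_on (irrep_space m) Q" and nd: "nondegenerate_on (irrep_space m) Q"
    and star: "star_rep (irrep_space m) (irrep m) Q"
  shows "Q (low_vec m 0) (low_vec m m) \<noteq> 0"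
proof
  assume z: "Q (low_vec m 0) (low_vec m m) = 0"
  have lin: "Q (low_vec m 0) (u + w) = Q (low_vec m 0) u + Q (low_vec m 0) w"
      "Q (low_vec m 0) (c *\<^sub>R u) = c * Q (low_vec m 0) u"
    if "u \<in> irrep_space m" "w \<in> irrep_space m" for u w c
    using Q that low_vec_in[of m 0] unfolding bilinear_on_def linear_on_def real_scaleR_def by blast+
  have "v \<in> irrep_space m \<and> Q (low_vec m 0) v = 0" if "v \<in> span (low_vec m ` {..m})" for v
    using that
  proof (induction rule: span_induct_alt)
    case base
    show ?case
      using lin(2)[OF low_vec_in low_vec_in, of 0 0]
      by (simp add: subspace_0[OF subspace_irrep_space])
  next
    case (step c x y)
    then obtain i where "i \<le> m" "x = low_vec m i" by auto
    then have x: "x \<in> irrep_space m" "Q (low_vec m 0) x = 0"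
      using star_form_low_vec[OF Q star, of 0 i] z by (simp_all add: low_vec_in)
    then have cx: "c *\<^sub>R x \<in> irrep_space m"
      by (intro subspace_scale subspace_irrep_space)
    show ?case
      using step x lin(1)[OF cx, of y] lin(2)[OF x(1) x(1), of c]
        subspace_add[OF subspace_irrep_space cx, of y] by simp
  qed
  then have "low_vec m 0 = 0"
    using nd low_vec_in[of m 0]
    by (auto simp: nondegenerate_on_def irrep_space_span_low_vec[symmetric])
  then show False using lookup_low_vec[of m 0 0] by simp
qed

lemma star_form_X_pow:
  assumes Q: "bilinear_on (irrep_space m) Q" and star: "star_rep (irrep_space m) (irrep m) Q"
    and i: "i \<le> m" and j: "j \<le> m"
  shows "Q (low_vec m i) ((irrep m sl2_X ^^ a) (low_vec m j)) =
    (if i + j + a = m then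
       Q (low_vec m 0) (low_vec m m) * (fact (m - i) * fact (m - j) / (fact i * fact j)) else 0)"
proof -
  have sc: "Q (low_vec m i) (c *\<^sub>R low_vec m b) = c * Q (low_vec m i) (low_vec m b)" for c b
    using Q low_vec_in by (auto simp: bilinear_on_def linear_on_def)
  show ?thesis
  proof (cases "j + a \<le> m")
    case True
    have "m - j - a = i" "j + a = m - i" if "i + j + a = m" using that by auto
    then show ?thesis
      using star_form_low_vec[OF Q star i True]
      by (auto simp: irrep_X_pow_low_vec[OF j] sc add.assoc mult_ac)
  next
    case False
    then have "low_vec m (j + a) = 0 *\<^sub>R low_vec m 0" by (simp add: low_vec_zero)
    then show ?thesis
      using False by (simp add: irrep_X_pow_low_vec[OF j] sc del: scaleR_zero_left)
  qed
qed

section \<open>Linearity and powers on the tensor product\<close>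

lemma tensor_form_superset:
  assumes "finite S" "Poly_Mapping.keys s \<subseteq> S" "finite T" "Poly_Mapping.keys t \<subseteq> T"
  shows "tensor_form Q R s t = (\<Sum>x\<in>S. \<Sum>y\<in>T.
     Poly_Mapping.lookup s x * Poly_Mapping.lookup t y *
     (Q (Poly_Mapping.single (fst x) 1) (Poly_Mapping.single (fst y) 1) *
      R (Poly_Mapping.single (snd x) 1) (Poly_Mapping.single (snd y) 1)))"
proof -
  have "tensor_form Q R s t = (\<Sum>x\<in>Poly_Mapping.keys s. \<Sum>y\<in>T.
     Poly_Mapping.lookup s x * Poly_Mapping.lookup t y *
     (Q (Poly_Mapping.single (fst x) 1) (Poly_Mapping.single (fst y) 1) *
      R (Poly_Mapping.single (snd x) 1) (Poly_Mapping.single (snd y) 1)))"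
    unfolding tensor_form_def case_prod_unfold prod.collapse
    by (intro sum.cong refl sum.mono_neutral_left) (use assms in \<open>auto simp: in_keys_iff\<close>)
  also have "\<dots> = (\<Sum>x\<in>S. \<Sum>y\<in>T.
     Poly_Mapping.lookup s x * Poly_Mapping.lookup t y *
     (Q (Poly_Mapping.single (fst x) 1) (Poly_Mapping.single (fst y) 1) *
      R (Poly_Mapping.single (snd x) 1) (Poly_Mapping.single (snd y) 1)))"
    by (rule sum.mono_neutral_left) (use assms in \<open>auto simp: in_keys_iff\<close>)
  finally show ?thesis .
qed

lemma linear_tensor_form_right:
  fixes s :: "'a \<times> 'b \<Rightarrow>\<^sub>0 real"
  shows "linear (tensor_form Q R s)"
proof (rule linearI)
  fix t t' :: "'a \<times> 'b \<Rightarrow>\<^sub>0 real" and c :: real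
  let ?T = "Poly_Mapping.keys t \<union> Poly_Mapping.keys t'"
  have k: "finite ?T" "Poly_Mapping.keys t \<subseteq> ?T" "Poly_Mapping.keys t' \<subseteq> ?T"
    "Poly_Mapping.keys (t + t') \<subseteq> ?T" "Poly_Mapping.keys (c *\<^sub>R t) \<subseteq> ?T"
    by (auto simp: in_keys_iff lookup_add lookup_scaleR)
  note s = finite_keys[of s] order_refl[of "Poly_Mapping.keys s"]
  show "tensor_form Q R s (t + t') = tensor_form Q R s t + tensor_form Q R s t'"
    unfolding tensor_form_superset[OF s k(1,2)] tensor_form_superset[OF s k(1,3)]
      tensor_form_superset[OF s k(1,4)] sum.distrib[symmetric]
    by (intro sum.cong refl) (simp add: lookup_add algebra_simps)
  show "tensor_form Q R s (c *\<^sub>R t) = c *\<^sub>R tensor_form Q R s t"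
    unfolding tensor_form_superset[OF s k(1,2)] tensor_form_superset[OF s k(1,5)] scaleR_sum_right
    by (intro sum.cong refl) (simp add: lookup_scaleR)
qed

lemma linear_tensor_form_left:
  fixes t :: "'a \<times> 'b \<Rightarrow>\<^sub>0 real"
  shows "linear (\<lambda>s. tensor_form Q R s t)"
proof (rule linearI)
  fix s s' :: "'a \<times> 'b \<Rightarrow>\<^sub>0 real" and c :: real
  let ?S = "Poly_Mapping.keys s \<union> Poly_Mapping.keys s'"
  have k: "finite ?S" "Poly_Mapping.keys s \<subseteq> ?S" "Poly_Mapping.keys s' \<subseteq> ?S"
    "Poly_Mapping.keys (s + s') \<subseteq> ?S" "Poly_Mapping.keys (c *\<^sub>R s) \<subseteq> ?S"
    by (auto simp: in_keys_iff lookup_add lookup_scaleR)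
  note t = finite_keys[of t] order_refl[of "Poly_Mapping.keys t"]
  show "tensor_form Q R (s + s') t = tensor_form Q R s t + tensor_form Q R s' t"
    unfolding tensor_form_superset[OF k(1,2) t] tensor_form_superset[OF k(1,3) t]
      tensor_form_superset[OF k(1,4) t] sum.distrib[symmetric]
    by (intro sum.cong refl) (simp add: lookup_add algebra_simps)
  show "tensor_form Q R (c *\<^sub>R s) t = c *\<^sub>R tensor_form Q R s t"
    unfolding tensor_form_superset[OF k(1,2) t] tensor_form_superset[OF k(1,5) t] scaleR_sum_right
    by (intro sum.cong refl) (simp add: lookup_scaleR)
qed

lemma linear_funpow: "linear f \<Longrightarrow> linear (f ^^ N)" for f :: "'a::real_vector \<Rightarrow> 'a"
  by (induction N) (simp_all add: linear_compose linear_id[unfolded id_def] id_def)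

text \<open>The operator is a sum of two commuting ones, each acting on one factor, so its powers follow
  the binomial theorem.\<close>

lemma tensor_rep_pow_tensor:
  assumes \<rho>: "linear (\<rho> A)" and \<sigma>: "linear (\<sigma> A)"
  shows "(tensor_rep \<rho> \<sigma> A ^^ N) (tensor u v) =
    (\<Sum>a\<le>N. real (N choose a) *\<^sub>R tensor ((\<rho> A ^^ a) u) ((\<sigma> A ^^ (N - a)) v))"
proof (induction N)
  case 0
  then show ?case by simp
next
  case (Suc N)
  let ?t = "\<lambda>a b. tensor ((\<rho> A ^^ a) u) ((\<sigma> A ^^ b) v)"
  have "(tensor_rep \<rho> \<sigma> A ^^ Suc N) (tensor u v)
      = (\<Sum>a\<le>N. real (N choose a) *\<^sub>R (?t (Suc a) (N - a) + ?t a (Suc N - a)))"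
    by (simp add: Suc linear_sum[OF linear_tensor_rep] linear_scale[OF linear_tensor_rep]
        tensor_rep_tensor[of \<rho> A \<sigma>, OF \<rho> \<sigma>] Suc_diff_le)
  also have "\<dots> = (\<Sum>a\<le>N. real (N choose a) *\<^sub>R ?t (Suc a) (N - a))
      + (\<Sum>a\<le>Suc N. real (N choose a) *\<^sub>R ?t a (Suc N - a))"
    by (simp add: scaleR_add_right sum.distrib binomial_eq_0)
  also have "(\<Sum>a\<le>Suc N. real (N choose a) *\<^sub>R ?t a (Suc N - a)) = ?t 0 (Suc N)
      + (\<Sum>a\<le>N. real (N choose Suc a) *\<^sub>R ?t (Suc a) (N - a))"
    by (simp only: sum.atMost_Suc_shift) simp
  also have "(\<Sum>a\<le>N. real (N choose a) *\<^sub>R ?t (Suc a) (N - a)) + (?t 0 (Suc N)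
      + (\<Sum>a\<le>N. real (N choose Suc a) *\<^sub>R ?t (Suc a) (N - a)))
      = (\<Sum>a\<le>Suc N. real (Suc N choose a) *\<^sub>R ?t a (Suc N - a))"
    by (simp only: sum.atMost_Suc_shift binomial_Suc_Suc of_nat_add scaleR_add_left sum.distrib)
      (simp add: algebra_simps)
  finally show ?case .
qed

section \<open>The form on the lowest weight vectors\<close>

text \<open>By weights, only the term with \<open>a = m - i - j\<close> powers of \<open>X\<close> on the first factor contributes to the
  binomial expansion. Its value is a quotient of factorials. The point of arranging it as on
  the right is that, apart from \<open>k choose j\<close>, the dependence on \<open>j\<close> is a product of two binomial
  coefficients, as in \<open>alternating_binomial_sum\<close>; their product vanishes exactly when
  there is no such term.\<close>

lemma tensor_pairing_X_pow:
  assumes Q: "bilinear_on (irrep_space m) Q" "star_rep (irrep_space m) (irrep m) Q"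
    and R: "bilinear_on (irrep_space n) R" "star_rep (irrep_space n) (irrep n) R"
    and k: "k \<le> m" "k \<le> n" and i: "i \<le> k" and j: "j \<le> k"
  defines "c \<equiv> Q (low_vec m 0) (low_vec m m)" and "d \<equiv> R (low_vec n 0) (low_vec n n)"
  shows "tensor_form Q R (tensor (low_vec m i) (low_vec n (k - i)))
      ((tensor_rep (irrep m) (irrep n) sl2_X ^^ (m + n - 2 * k))
        (tensor (low_vec m j) (low_vec n (k - j)))) =
    c * d * (fact (m + n - 2 * k) / fact k) * (fact (m - i) * fact (n - k + i)) *
    (real (k choose j) * real ((m - j) choose i) * real ((n - k + j) choose (k - i)))"
    (is "?lhs = ?rhs")
proof -
  define N where "N = m + n - 2 * k"
  have Xin: "(irrep l sl2_X ^^ a) (low_vec l b) \<in> irrep_space l" for l a b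
    by (cases a) (simp_all add: low_vec_in irrep_closed)
  have lin: "linear (irrep m sl2_X)" "linear (irrep n sl2_X)" by (rule linear_irrep)+
  define g where "g a = real (N choose a) *
      (Q (low_vec m i) ((irrep m sl2_X ^^ a) (low_vec m j)) *
       R (low_vec n (k - i)) ((irrep n sl2_X ^^ (N - a)) (low_vec n (k - j))))" for a
  have lhs: "?lhs = (\<Sum>a\<le>N. g a)"
    unfolding N_def[symmetric] tensor_rep_pow_tensor[of "irrep m" sl2_X "irrep n", OF lin]
      linear_sum[OF linear_tensor_form_right] linear_scale[OF linear_tensor_form_right]
      tensor_form_tensor[OF Q(1) R(1) low_vec_in Xin low_vec_in Xin] g_def by simp
  have g0: "g a = 0" if "i + j + a \<noteq> m" for a
    using star_form_X_pow[OF Q, of i j a] that i j k by (simp add: g_def)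
  show ?thesis
  (* The condition says that a = m - i - j is an honest exponent: neither a nor N - a is negative. *)
  proof (cases "i + j \<le> m \<and> 2 * k \<le> n + i + j")
    case False
    have "g a = 0" if "a \<le> N" for a
      using that False g0[of a] k by (cases "i + j + a = m") (auto simp: N_def)
    moreover have "(m - j) choose i = 0 \<or> (n - k + j) choose (k - i) = 0"
      using False i j k by (auto simp: not_le intro!: binomial_eq_0)
    ultimately show ?thesis unfolding lhs by auto
  next
    case True
    define a where "a = m - i - j"
    have a: "i + j + a = m" "a \<le> N" "(k - i) + (k - j) + (N - a) = n"
      "N - a = n + i + j - 2 * k" "m - j - i = a" "n - k + j - (k - i) = N - a"
      "n - (k - i) = n - k + i" "n - (k - j) = n - k + j"
      using True i j k by (auto simp: a_def N_def)
    have "?lhs = g a"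
      unfolding lhs using a(1,2) g0 by (subst sum.remove[of _ a]) (auto intro!: sum.neutral)
    also have "\<dots> = real (N choose a) *
        ((c * (fact (m - i) * fact (m - j) / (fact i * fact j))) *
         (d * (fact (n - k + i) * fact (n - k + j) / (fact (k - i) * fact (k - j)))))"
      using star_form_X_pow[OF Q, of i j a] star_form_X_pow[OF R, of "k - i" "k - j" "N - a"] a i j k
      by (simp add: g_def c_def d_def)
    also have "\<dots> = ?rhs"
    proof -
      have "i \<le> m - j" "k - i \<le> n - k + j" using True i j k by auto
      then show ?thesis
        unfolding N_def[symmetric] using a(2,5,6) j
        by (simp add: binomial_fact field_simps)
    qed
    finally show ?thesis .
  qed
qed

definition lowest_weight_vec :: "nat \<Rightarrow> nat \<Rightarrow> nat \<Rightarrow> int \<times> int \<Rightarrow>\<^sub>0 real" where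
  "lowest_weight_vec m n k = (\<Sum>i\<le>k. (-1) ^ i *\<^sub>R tensor (low_vec m i) (low_vec n (k - i)))"

text \<open>For fixed \<open>i\<close> the sum over \<open>j\<close> is an alternating binomial sum of sign \<open>(-1) ^ (k - i)\<close>. This sign
  and the coefficient \<open>(-1) ^ i\<close> of the vector combine to \<open>(-1) ^ k\<close>, the same for all \<open>i\<close>, so that what
  remains is a sum of positive terms.\<close>

lemma omega_lowest_weight_vec:
  assumes Q: "bilinear_on (irrep_space m) Q" "star_rep (irrep_space m) (irrep m) Q"
    and R: "bilinear_on (irrep_space n) R" "star_rep (irrep_space n) (irrep n) R"
    and k: "k \<le> m" "k \<le> n"
  shows "omega Q R m n k (lowest_weight_vec m n k) (lowest_weight_vec m n k) =
    (-1) ^ k * (Q (low_vec m 0) (low_vec m m) * R (low_vec n 0) (low_vec n n)) *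
    (fact (m + n - 2 * k) / fact k *
      (\<Sum>i\<le>k. fact (m - i) * fact (n - k + i) * real (k choose i)))"
proof -
  define C where "C = Q (low_vec m 0) (low_vec m m) * R (low_vec n 0) (low_vec n n) *
    (fact (m + n - 2 * k) / fact k)"
  let ?X = "tensor_rep (irrep m) (irrep n) sl2_X ^^ (m + n - 2 * k)"
  let ?b = "\<lambda>i. tensor (low_vec m i) (low_vec n (k - i))"
  have linX: "linear ?X" by (intro linear_funpow linear_tensor_rep)
  have left: "tensor_form Q R (lowest_weight_vec m n k) t
      = (\<Sum>i\<le>k. (-1) ^ i * tensor_form Q R (?b i) t)"
    for t
    unfolding lowest_weight_vec_def linear_sum[OF linear_tensor_form_left]
      linear_scale[OF linear_tensor_form_left] by simp
  have right: "tensor_form Q R s (?X (lowest_weight_vec m n k))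
      = (\<Sum>j\<le>k. (-1) ^ j * tensor_form Q R s (?X (?b j)))" for s
    unfolding lowest_weight_vec_def linear_sum[OF linX] linear_scale[OF linX]
      linear_sum[OF linear_tensor_form_right] linear_scale[OF linear_tensor_form_right] by simp
  have "omega Q R m n k (lowest_weight_vec m n k) (lowest_weight_vec m n k)
      = (\<Sum>i\<le>k. (-1) ^ i * (\<Sum>j\<le>k. (-1) ^ j * tensor_form Q R (?b i) (?X (?b j))))"
    unfolding omega_def left unfolding right ..
  also have "\<dots> = (\<Sum>i\<le>k. (-1) ^ i * (\<Sum>j\<le>k. (-1) ^ j * (C * (fact (m - i) * fact (n - k + i)) *
    (real (k choose j) * real ((m - j) choose i) * real ((n - k + j) choose (k - i))))))"
    by (intro sum.cong refl arg_cong2[where f = "(*)"])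
      (simp add: tensor_pairing_X_pow[OF Q R k] C_def)
  also have "\<dots> = (\<Sum>i\<le>k. (-1) ^ i * (C * (fact (m - i) * fact (n - k + i)) *
    (\<Sum>j\<le>k. (-1) ^ j * real (k choose j) * real ((m - j) choose i) *
      real ((n - k + j) choose (k - i)))))"
    by (simp add: sum_distrib_left mult_ac)
  also have "\<dots> = (\<Sum>i\<le>k. (-1) ^ i * (C * (fact (m - i) * fact (n - k + i)) *
    ((-1) ^ (k - i) * real (k choose i))))"
    by (intro sum.cong refl, subst alternating_binomial_sum[OF _ k(1)]) simp_all
  also have "\<dots> = (\<Sum>i\<le>k. (-1) ^ k * C * (fact (m - i) * fact (n - k + i) * real (k choose i)))"
  proof (intro sum.cong refl)
    fix i assume "i \<in> {..k}"
    then have "(-1) ^ i * (-1) ^ (k - i) = ((-1) ^ k :: real)"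
      by (simp flip: power_add)
    then show "(-1) ^ i * (C * (fact (m - i) * fact (n - k + i)) *
        ((-1) ^ (k - i) * real (k choose i))) =
        (-1) ^ k * C * (fact (m - i) * fact (n - k + i) * real (k choose i))"
      by (simp add: mult_ac)
  qed
  finally show ?thesis by (simp add: C_def sum_distrib_left mult_ac)
qed

section \<open>Uniqueness of lowest weight vectors up to scaling\<close>

lemma tensor_space_expand:
  assumes "v \<in> tensor_space (irrep_space m) (irrep_space n)"
  shows "v = (\<Sum>i\<le>m. \<Sum>j\<le>n. Poly_Mapping.lookup v (2 * int i - int m, 2 * int j - int n) *\<^sub>R
    tensor (low_vec m i) (low_vec n j))"
proof -
  let ?W = "weights m \<times> weights n"
  have fin: "finite ?W" by (simp add: weights_def)
  have keys: "Poly_Mapping.keys v \<subseteq> ?W"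
    using assms unfolding tensor_space_def
  proof (induction rule: span_induct_alt)
    case (step c x y)
    then have "Poly_Mapping.keys x \<subseteq> ?W"
      using keys_irrep_space by (fastforce simp: keys_tensor)
    moreover have "Poly_Mapping.keys (c *\<^sub>R x + y) \<subseteq> Poly_Mapping.keys x \<union> Poly_Mapping.keys y"
      by (auto simp: in_keys_iff lookup_add lookup_scaleR)
    ultimately show ?case using step by blast
  qed simp
  have inj: "inj_on (\<lambda>i. 2 * int i - int l) {..l}" for l by (auto intro: inj_onI)
  have single: "Poly_Mapping.single (2 * int i - int m, 2 * int j - int n) 1
      = tensor (low_vec m i) (low_vec n j)" if "i \<le> m" "j \<le> n" for i j
    using that
    by (intro poly_mapping_eqI) (auto simp: low_vec_single lookup_single when_def split_paired_all)
  have "v = (\<Sum>p\<in>?W. Poly_Mapping.lookup v p *\<^sub>R Poly_Mapping.single p 1)"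
    by (rule expand_single[OF fin keys])
  also have "\<dots> = (\<Sum>p\<in>weights m. \<Sum>q\<in>weights n.
      Poly_Mapping.lookup v (p, q) *\<^sub>R Poly_Mapping.single (p, q) 1)"
    by (simp add: sum.cartesian_product case_prod_unfold)
  also have "\<dots> = (\<Sum>i\<le>m. \<Sum>j\<le>n. Poly_Mapping.lookup v (2 * int i - int m, 2 * int j - int n) *\<^sub>R
      Poly_Mapping.single (2 * int i - int m, 2 * int j - int n) 1)"
    by (simp add: weights_low sum.reindex[OF inj])
  also have "\<dots> = (\<Sum>i\<le>m. \<Sum>j\<le>n. Poly_Mapping.lookup v (2 * int i - int m, 2 * int j - int n) *\<^sub>R
      tensor (low_vec m i) (low_vec n j))"
    by (intro sum.cong refl) (simp add: single)
  finally show ?thesis .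
qed

text \<open>The eigenvalue of \<open>H\<close> leaves only the basis tensors with indices \<open>(i, k - i)\<close>. In \<open>Y v\<close>, the basis
  tensor with indices \<open>(i, k - i - 1)\<close> arises from exactly two of them, so \<open>Y v = 0\<close> forces consecutive
  coefficients to be opposite.\<close>

lemma P_space_multiple:
  assumes v: "v \<in> P_space m n k" and k: "k \<le> m" "k \<le> n"
  shows "\<exists>\<alpha>. v = \<alpha> *\<^sub>R lowest_weight_vec m n k"
proof -
  let ?T = "tensor_rep (irrep m) (irrep n)"
  define A where "A i j = Poly_Mapping.lookup v (2 * int i - int m, 2 * int j - int n)" for i j
  have expand: "v = (\<Sum>i\<le>m. \<Sum>j\<le>n. A i j *\<^sub>R tensor (low_vec m i) (low_vec n j))"
    unfolding A_def using v by (intro tensor_space_expand) (simp add: P_space_def)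
  have act: "?T B v = (\<Sum>i\<le>m. \<Sum>j\<le>n. A i j *\<^sub>R
      (tensor (irrep m B (low_vec m i)) (low_vec n j) + tensor (low_vec m i) (irrep n B (low_vec n j))))"
    for B
    by (subst expand) (simp only: linear_sum[OF linear_tensor_rep] linear_scale[OF linear_tensor_rep]
        tensor_rep_tensor[of "irrep m" B "irrep n", OF linear_irrep linear_irrep])
  have weight: "A i j = 0" if ij: "i \<le> m" "j \<le> n" "i + j \<noteq> k" for i j
  proof -
    let ?p = "(2 * int i - int m, 2 * int j - int n)"
    have Hv: "?T sl2_H v = (- real m - real n + 2 * real k) *\<^sub>R v"
      using v by (simp add: P_space_def)
    have "Poly_Mapping.lookup (?T sl2_H v) ?p =
      (\<Sum>i'\<le>m. \<Sum>j'\<le>n. if i' = i \<and> j' = j then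
        (2 * real i - real m + (2 * real j - real n)) * A i j else 0)"
      unfolding act lookup_sum lookup_scaleR lookup_add lookup_tensor irrep_H_low_vec lookup_low_vec
      by (intro sum.cong refl) (auto simp: algebra_simps)
    also have "\<dots> = (\<Sum>i'\<le>m. if i' = i then
        (2 * real i - real m + (2 * real j - real n)) * A i j else 0)"
      using ij by (intro sum.cong refl) auto
    also have "\<dots> = (2 * real i - real m + (2 * real j - real n)) * A i j"
      using ij by simp
    finally have "(2 * real i - real m + (2 * real j - real n)) * A i j
        = (- real m - real n + 2 * real k) * A i j"
      by (simp only: Hv lookup_scaleR A_def real_scaleR_def)
    moreover have "2 * real i - real m + (2 * real j - real n) \<noteq> - real m - real n + 2 * real k"
      using ij by linarith
    ultimately show ?thesis by (metis mult_right_cancel)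
  qed
  have lookup_Y: "Poly_Mapping.lookup (irrep l sl2_Y (low_vec l a)) (2 * int b - int l)
      = (if a = Suc b then 1 else 0)" if "a \<le> l" for l a b
    using that
    by (cases a) (auto simp: irrep_Y_low_vec_0 irrep_Y_low_vec_Suc lookup_low_vec)
  have step: "A (Suc i) (k - Suc i) = - A i (k - i)" if i: "Suc i \<le> k" for i
  proof -
    let ?j = "k - Suc i"
    let ?p = "(2 * int i - int m, 2 * int ?j - int n)"
    have "0 = Poly_Mapping.lookup (?T sl2_Y v) ?p"
      using v by (simp add: P_space_def)
    also have "\<dots> = (\<Sum>i'\<le>m. \<Sum>j'\<le>n. (if i' = Suc i then if j' = ?j then A (Suc i) ?j else 0 else 0)
        + (if i' = i then if j' = Suc ?j then A i (Suc ?j) else 0 else 0))"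
      unfolding act lookup_sum lookup_scaleR lookup_add lookup_tensor lookup_low_vec
      by (intro sum.cong refl) (auto simp: lookup_Y)
    also have "\<dots> = (\<Sum>i'\<le>m. (if i' = Suc i then A (Suc i) ?j else 0)
        + (if i' = i then A i (Suc ?j) else 0))"
      unfolding sum.distrib using i k by (intro sum.cong refl arg_cong2[where f = "(+)"]) auto
    also have "\<dots> = A (Suc i) ?j + A i (Suc ?j)"
      unfolding sum.distrib using i k by simp
    finally show ?thesis using i by (simp add: Suc_diff_Suc)
  qed
  have alt: "A i (k - i) = (-1) ^ i * A 0 k" if "i \<le> k" for i
    using that by (induction i) (simp_all add: step)
  have "v = (\<Sum>i\<le>m. if i \<le> k then A i (k - i) *\<^sub>R tensor (low_vec m i) (low_vec n (k - i)) else 0)"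
  proof (subst expand, intro sum.cong refl)
    fix i assume i: "i \<in> {..m}"
    have "(\<Sum>j\<le>n. A i j *\<^sub>R tensor (low_vec m i) (low_vec n j))
      = (\<Sum>j\<le>n. if j = k - i then if i \<le> k then
          A i (k - i) *\<^sub>R tensor (low_vec m i) (low_vec n (k - i)) else 0 else 0)"
      using i by (intro sum.cong refl) (auto simp: weight)
    also have "\<dots> = (if i \<le> k then A i (k - i) *\<^sub>R tensor (low_vec m i) (low_vec n (k - i)) else 0)"
      using le_trans[OF diff_le_self k(2), of i] by simp
    finally show "(\<Sum>j\<le>n. A i j *\<^sub>R tensor (low_vec m i) (low_vec n j)) =
      (if i \<le> k then A i (k - i) *\<^sub>R tensor (low_vec m i) (low_vec n (k - i)) else 0)" .
  qed
  also have "\<dots> = (\<Sum>i\<le>k. A i (k - i) *\<^sub>R tensor (low_vec m i) (low_vec n (k - i)))"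
    using k by (intro sum.mono_neutral_cong_right) auto
  also have "\<dots> = A 0 k *\<^sub>R lowest_weight_vec m n k"
    by (simp add: lowest_weight_vec_def scaleR_sum_right alt mult.commute)
  finally show ?thesis by blast
qed

section \<open>Alternating definiteness\<close>

theorem theorem5:
  fixes m n :: nat
    and Q R :: "(int \<Rightarrow>\<^sub>0 real) \<Rightarrow> (int \<Rightarrow>\<^sub>0 real) \<Rightarrow> real"
  assumes "bilinear_on (irrep_space m) Q"
    and "symmetric_on (irrep_space m) Q"
    and "nondegenerate_on (irrep_space m) Q"
    and "star_rep (irrep_space m) (irrep m) Q"
    and "bilinear_on (irrep_space n) R"
    and "symmetric_on (irrep_space n) R"
    and "nondegenerate_on (irrep_space n) R"
    and "star_rep (irrep_space n) (irrep n) R"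
  shows "\<exists>\<epsilon>\<in>{1, -1::real}. \<forall>k\<le>min m n.
           pos_definite_on (P_space m n k) (\<lambda>v w. \<epsilon> * (-1) ^ k * omega Q R m n k v w)"
proof -
  define C where "C = Q (low_vec m 0) (low_vec m m) * R (low_vec n 0) (low_vec n n)"
  have C: "C \<noteq> 0"
    using star_form_const_nonzero[OF assms(1,3,4)] star_form_const_nonzero[OF assms(5,7,8)]
    by (simp add: C_def)
  have "0 < sgn C * (-1) ^ k * omega Q R m n k v v"
    if k: "k \<le> m" "k \<le> n" and v: "v \<in> P_space m n k" "v \<noteq> 0" for k v
  proof -
    define S where "S = fact (m + n - 2 * k) / fact k *
      (\<Sum>i\<le>k. fact (m - i) * fact (n - k + i) * real (k choose i))"
    have S: "S > 0"
      unfolding S_def by (intro mult_pos_pos divide_pos_pos sum_pos) auto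
    obtain \<alpha> where \<alpha>: "v = \<alpha> *\<^sub>R lowest_weight_vec m n k"
      using P_space_multiple[OF v(1) k] by blast
    with v have \<alpha>0: "\<alpha> \<noteq> 0" by auto
    have linX: "linear (tensor_rep (irrep m) (irrep n) sl2_X ^^ (m + n - 2 * k))"
      by (intro linear_funpow linear_tensor_rep)
    have "omega Q R m n k v v
        = \<alpha>\<^sup>2 * omega Q R m n k (lowest_weight_vec m n k) (lowest_weight_vec m n k)"
      unfolding omega_def \<alpha> linear_scale[OF linX] linear_scale[OF linear_tensor_form_left]
        linear_scale[OF linear_tensor_form_right] by (simp add: power2_eq_square)
    also have "\<dots> = \<alpha>\<^sup>2 * ((-1) ^ k * C * S)"
      unfolding omega_lowest_weight_vec[OF assms(1,4,5,8) k] C_def S_def by simp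
    finally have "sgn C * (-1) ^ k * omega Q R m n k v v
        = ((-1) ^ k * (-1) ^ k) * (sgn C * C) * (\<alpha>\<^sup>2 * S)" by (simp add: mult_ac)
    also have "\<dots> = \<bar>C\<bar> * (\<alpha>\<^sup>2 * S)"
      by (simp add: abs_sgn mult.commute flip: power_mult_distrib)
    finally show ?thesis using C S \<alpha>0 by simp
  qed
  moreover have "sgn C \<in> {1, -1}" using C by (simp add: sgn_if)
  ultimately show ?thesis
    by (intro bexI[of _ "sgn C"]) (auto simp: pos_definite_on_def)
qed

end
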